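(* In the line-square setting described in the context, suppose that $-1<a_1(1)<u(1)$ and $1<a_1(2)$. Then Dykstra's algorithm and MAP produce exactly the same main sequences, i.e. $c_{2n-1}=a_n$ and $c_{2n}=b_n$ for all $n\ge 1$, with infinite convergence, i.e. the sequences converge to $P_{A\cap B}(z)$ but do not reach it in finitely many steps.
   Context: Line-square setting: $X=\mathbb{R}^2$ with the Euclidean inner product $\langle\cdot,\cdot\rangle$ and norm; for $x\in\mathbb{R}^2$ write $x=(x(1),x(2))$, and likewise $x_n=(x_n(1),x_n(2))$ for sequences. $z\in X$ is arbitrary. $B=[-1,1]\times[-1,1]$. $A$ is a line in $\mathbb{R}^2$ of the form $A=u+\{v\}^\perp$, where $u\in A\cap B$ satisfies $u(1)>-1$ and $u(2)=1$, and $v\in (A-A)^\perp$ satisfies $\|v\|=1$, $v(1)>0$, $v(2)>0$. $P_C$ denotes the projection onto a nonempty closed convex set $C$. Dykstra's algorithm for $(A,B,z)$: set $b_0=z$, $p_0=0$, $q_0=0$ and for $n\ge 1$ $a_n=P_A(b_{n-1}+p_{n-1})$, $p_n=b_{n-1}+p_{n-1}-a_n$, $b_n=P_B(a_n+q_{n-1})$, $q_n=a_n+q_{n-1}-b_n$. The main sequences are $(a_n)$ and $(b_n)$; the auxiliary sequences are $(p_n)$ and $(q_n)$. Method of alternating projections (MAP): $c_0=z$, and $c_{2n-1}=P_A(c_{2n-2})$, $c_{2n}=P_B(c_{2n-1})$ for $n\ge 1$. *)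

theory Defs
  imports "HOL-Analysis.Analysis"
begin

text \<open>For a nonempty closed convex set \<open>C\<close>, the projection \<open>P\<^sub>C\<close> is
  \<^term>\<open>closest_point C\<close>. The value \<open>a 0\<close> does not occur in the algorithm
  and is left unconstrained.\<close>

definition dykstra ::
  "'a::euclidean_space set \<Rightarrow> 'a set \<Rightarrow> 'a \<Rightarrow>
    (nat \<Rightarrow> 'a) \<Rightarrow> (nat \<Rightarrow> 'a) \<Rightarrow> (nat \<Rightarrow> 'a) \<Rightarrow> (nat \<Rightarrow> 'a) \<Rightarrow> bool" where
  "dykstra A B z a b p q \<longleftrightarrow>
    b 0 = z \<and> p 0 = 0 \<and> q 0 = 0 \<and>
    (\<forall>n\<ge>1.
      a n = closest_point A (b (n - 1) + p (n - 1)) \<and>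
      p n = b (n - 1) + p (n - 1) - a n \<and>
      b n = closest_point B (a n + q (n - 1)) \<and>
      q n = a n + q (n - 1) - b n)"

definition MAP ::
  "'a::euclidean_space set \<Rightarrow> 'a set \<Rightarrow> 'a \<Rightarrow> (nat \<Rightarrow> 'a) \<Rightarrow> bool" where
  "MAP A B z c \<longleftrightarrow>
    c 0 = z \<and>
    (\<forall>n\<ge>1.
      c (2 * n - 1) = closest_point A (c (2 * n - 2)) \<and>
      c (2 * n) = closest_point B (c (2 * n - 1)))"

text \<open>Only the terms from index 1 on are required to differ from the limit,
  since the sequence \<open>a\<close> above starts there.\<close>

definition infinite_convergence :: "(nat \<Rightarrow> 'a::topological_space) \<Rightarrow> 'a \<Rightarrow> bool" where
  "infinite_convergence x l \<longleftrightarrow> x \<longlonglongrightarrow> l \<and> (\<forall>n\<ge>1. x n \<noteq> l)"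

end

theory Submission
  imports Defs "HOL-Probability.Characteristic_Functions"
begin

text \<open>Put \<open>w = (v(2), -v(1))\<close>, so that \<open>v, w\<close> is an orthonormal basis and \<open>A = u + \<real> w\<close>.
  The hypotheses on \<open>a\<^sub>1\<close> say that \<open>a\<^sub>1 = u - s w\<close> for some \<open>s > 0\<close>. Since \<open>p\<^sub>n\<close> is always a multiple
  of \<open>v\<close>, it does not affect the projection onto \<open>A\<close>; since \<open>q\<^sub>n\<close> is always a nonnegative multiple of
  \<open>(0, 1)\<close> and all the points stay above the upper edge of the square, it does not affect the
  projection onto \<open>B\<close>. Both algorithms therefore yield
  \<open>a\<^sub>n = u - s r\<^sup>n\<^sup>-\<^sup>1 w\<close> and \<open>b\<^sub>n = u - s r\<^sup>n\<^sup>-\<^sup>1 v(2) (1, 0)\<close> with \<open>r = v(2)\<^sup>2 \<in> (0, 1)\<close>, whose common limit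
  \<open>u\<close> is the projection of \<open>z\<close>, because points of \<open>A \<inter> B\<close> have the form \<open>u + t w\<close> with \<open>t \<ge> 0\<close>.\<close>

section \<open>Projections onto a hyperplane and onto the square\<close>

lemma closest_point_eqI:
  fixes x z :: "'a::euclidean_space"
  assumes "convex S" "closed S" "x \<in> S" and obtuse: "\<And>y. y \<in> S \<Longrightarrow> (z - x) \<bullet> (y - x) \<le> 0"
  shows "closest_point S z = x"
proof -
  have "dist z x \<le> dist z y" if "y \<in> S" for y
  proof -
    \<comment> \<open>Expanding around \<open>x\<close> turns the obtuse-angle condition into
      minimality of the distance: the cross term only adds to it.\<close>
    have "(z - y) \<bullet> (z - y) = (z - x) \<bullet> (z - x) - 2 * ((z - x) \<bullet> (y - x)) + (y - x) \<bullet> (y - x)"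
      by (simp add: inner_diff_left inner_diff_right inner_commute)
    then have "(z - x) \<bullet> (z - x) \<le> (z - y) \<bullet> (z - y)"
      using obtuse[OF that] inner_ge_zero[of "y - x"] by linarith
    then show ?thesis
      by (simp add: dist_norm norm_le)
  qed
  then show ?thesis
    using closest_point_unique[OF assms(1-3)] by metis
qed

text \<open>The residual \<open>k *\<^sub>R v\<close> is normal to the hyperplane. This is why
  adding \<open>p n\<close> does not change the projection onto the line.\<close>

lemma closest_point_hyperplane:
  fixes u v x :: "'a::euclidean_space"
  assumes "v \<bullet> (x - u) = 0"
  shows "closest_point {y. v \<bullet> (y - u) = 0} (x + k *\<^sub>R v) = x"
proof -
  have eq: "{y. v \<bullet> (y - u) = 0} = {y. v \<bullet> y = v \<bullet> u}"
    by (auto simp: inner_diff_right)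
  show ?thesis
    unfolding eq
    by (rule closest_point_eqI)
      (use assms in \<open>auto simp: convex_hyperplane closed_hyperplane inner_diff_right\<close>)
qed

definition square :: "(real^2) set" where
  "square = {x. x $ 1 \<in> {-1..1} \<and> x $ 2 \<in> {-1..1}}"

lemma square_eq_cbox: "square = cbox (vector [-1, -1]) (vector [1, 1])"
  by (auto simp: square_def mem_box_cart forall_2)

lemma convex_square: "convex square" and closed_square: "closed square"
  unfolding square_eq_cbox by (rule convex_box closed_cbox)+

lemma inner_vec_2: "x \<bullet> y = x $ 1 * y $ 1 + x $ 2 * y $ 2" for x y :: "real^2"
  by (simp add: inner_vec_def sum_2)

text \<open>The residual points vertically upwards, and no point of the square lies above height
  1.\<close>

lemma closest_point_square_above:
  assumes "-1 \<le> x $ 1" "x $ 1 \<le> 1" "1 \<le> x $ 2"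
  shows "closest_point square x = vector [x $ 1, 1]"
proof (rule closest_point_eqI[OF convex_square closed_square])
  show "(vector [x $ 1, 1] :: real^2) \<in> square"
    using assms by (simp add: square_def)
  fix y assume "y \<in> square"
  then show "(x - vector [x $ 1, 1]) \<bullet> (y - vector [x $ 1, 1]) \<le> 0"
    using assms by (auto simp: inner_vec_2 square_def mult_le_0_iff)
qed

section \<open>The orthonormal frame \<open>w\<close>, \<open>v\<close> and the half-steps between
  line and square\<close>

locale line_square =
  fixes u v :: "real^2"
  assumes u1: "-1 < u $ 1" "u $ 1 \<le> 1" and u2: "u $ 2 = 1"
    and v: "v $ 1 > 0" "v $ 2 > 0" "norm v = 1"
begin

definition line :: "(real^2) set" where
  "line = {x. v \<bullet> (x - u) = 0}"

definition w :: "real^2" where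
  "w = vector [v $ 2, - v $ 1]"

lemma w_simps [simp]: "w $ 1 = v $ 2" "w $ 2 = - v $ 1"
  by (simp_all add: w_def)

lemma v_sq: "(v $ 1)\<^sup>2 + (v $ 2)\<^sup>2 = 1"
  using v(3) by (simp add: norm_eq_1 inner_vec_2 power2_eq_square)

lemma ratio: "0 < (v $ 2)\<^sup>2" "(v $ 2)\<^sup>2 < 1"
  using v v_sq by (simp_all add: less_le)
    (smt (verit) zero_less_power)+

lemma u_plus_w_in_line: "v \<bullet> (u + t *\<^sub>R w - u) = 0"
  by (simp add: inner_vec_2)

lemma closest_point_line: "closest_point line (u + t *\<^sub>R w + k *\<^sub>R v) = u + t *\<^sub>R w"
  unfolding line_def by (rule closest_point_hyperplane[OF u_plus_w_in_line])

lemma decompose: "x = u + (w \<bullet> (x - u)) *\<^sub>R w + (v \<bullet> (x - u)) *\<^sub>R v"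
proof -
  have "y = (w \<bullet> y) *\<^sub>R w + (v \<bullet> y) *\<^sub>R v" for y :: "real^2"
  proof -
    \<comment> \<open>Multiplying by \<open>norm v\<close> squared makes the basis expansion a
      polynomial identity in each coordinate.\<close>
    have "y = ((v $ 1)\<^sup>2 + (v $ 2)\<^sup>2) *\<^sub>R y"
      by (simp add: v_sq)
    also have "\<dots> = (w \<bullet> y) *\<^sub>R w + (v \<bullet> y) *\<^sub>R v"
      by (simp add: vec_eq_iff forall_2 inner_vec_2 power2_eq_square algebra_simps)
    finally show ?thesis .
  qed
  from this[of "x - u"] show ?thesis by (simp add: algebra_simps)
qed

lemma closest_point_line_eq: "closest_point line x = u + (w \<bullet> (x - u)) *\<^sub>R w"
  by (subst decompose[of x]) (rule closest_point_line)

text \<open>The foot of the vertical through \<open>u - t *\<^sub>R w\<close> on the line carrying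
  the upper edge.\<close>

definition edge_point :: "real \<Rightarrow> real^2" where
  "edge_point t = u - (t * v $ 2) *\<^sub>R axis 1 1"

text \<open>Source of the ratio: one factor \<open>v $ 2\<close> sits in \<open>edge_point\<close>,
  the other is the inner product of \<open>axis 1 1\<close> with \<open>w\<close>.\<close>

lemma closest_point_line_edge:
  "closest_point line (edge_point t + k *\<^sub>R v) = u - (t * (v $ 2)\<^sup>2) *\<^sub>R w"
proof -
  have "edge_point t = u - (t * v $ 2 * ((v $ 1)\<^sup>2 + (v $ 2)\<^sup>2)) *\<^sub>R axis 1 1"
    by (simp add: edge_point_def v_sq)
  \<comment> \<open>Here \<open>axis 1 1\<close> is expanded as
    \<open>v $ 2 *\<^sub>R w + v $ 1 *\<^sub>R v\<close>.\<close>
  also have "\<dots> = u + (- (t * (v $ 2)\<^sup>2)) *\<^sub>R w + (- (t * v $ 2 * v $ 1)) *\<^sub>R v"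
    by (simp add: vec_eq_iff forall_2 axis_def power2_eq_square algebra_simps)
  finally have "edge_point t + k *\<^sub>R v =
      u + (- (t * (v $ 2)\<^sup>2)) *\<^sub>R w + (k - t * v $ 2 * v $ 1) *\<^sub>R v"
    by (simp add: algebra_simps)
  then show ?thesis
    using closest_point_line[of "- (t * (v $ 2)\<^sup>2)"] by simp
qed

text \<open>The bounds on \<open>t\<close> place the point vertically above the edge, and raising it
  by \<open>h\<close> keeps its foot. Dykstra's correction enters as \<open>h\<close>; MAP is the
  case \<open>h = 0\<close>.\<close>

lemma closest_point_square_line:
  assumes "0 \<le> t" "t * v $ 2 \<le> u $ 1 + 1" "0 \<le> h"
  shows "closest_point square (u - t *\<^sub>R w + h *\<^sub>R axis 2 1) = edge_point t"
proof -
  let ?x = "u - t *\<^sub>R w + h *\<^sub>R axis 2 1"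
  have x: "?x $ 1 = u $ 1 - t * v $ 2" "?x $ 2 = 1 + t * v $ 1 + h"
    by (simp_all add: axis_def u2)
  have "0 \<le> t * v $ 1" "0 \<le> t * v $ 2"
    using v assms by simp_all
  then have "-1 \<le> ?x $ 1" "?x $ 1 \<le> 1" "1 \<le> ?x $ 2"
    unfolding x using assms u1 by linarith+
  then have "closest_point square ?x = vector [?x $ 1, 1]"
    by (rule closest_point_square_above)
  then show ?thesis
    by (simp add: vec_eq_iff forall_2 axis_def edge_point_def u2)
qed

section \<open>Closed forms of both algorithms\<close>

lemma closed_form_bounds:
  assumes "0 \<le> s" "s * v $ 2 \<le> u $ 1 + 1"
  shows "0 \<le> s * ((v $ 2)\<^sup>2) ^ n" "s * ((v $ 2)\<^sup>2) ^ n * v $ 2 \<le> u $ 1 + 1"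
proof -
  show "0 \<le> s * ((v $ 2)\<^sup>2) ^ n" using assms by simp
  have "s * ((v $ 2)\<^sup>2) ^ n \<le> s"
    by (rule mult_left_le[OF power_le_one[OF less_imp_le[OF ratio(1)] less_imp_le[OF ratio(2)]] assms(1)])
  then have "s * ((v $ 2)\<^sup>2) ^ n * v $ 2 \<le> s * v $ 2"
    using v by (intro mult_right_mono) auto
  then show "s * ((v $ 2)\<^sup>2) ^ n * v $ 2 \<le> u $ 1 + 1"
    using assms by linarith
qed

lemma dykstra_closed_form:
  assumes D: "dykstra line square z a b p q"
    and a1: "a 1 = u - s *\<^sub>R w" and s: "0 \<le> s" "s * v $ 2 \<le> u $ 1 + 1"
  shows "a (Suc n) = u - (s * ((v $ 2)\<^sup>2) ^ n) *\<^sub>R w \<and> b (Suc n) = edge_point (s * ((v $ 2)\<^sup>2) ^ n)"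
proof -
  let ?t = "\<lambda>n. s * ((v $ 2)\<^sup>2) ^ n"
  note t = closed_form_bounds[OF s]
  have init: "b 0 = z" "p 0 = 0" "q 0 = 0"
    and step: "a (Suc n) = closest_point line (b n + p n)" "p (Suc n) = b n + p n - a (Suc n)"
      "b (Suc n) = closest_point square (a (Suc n) + q n)" "q (Suc n) = a (Suc n) + q n - b (Suc n)"
    for n
    using D unfolding dykstra_def by (auto dest: spec[of _ "Suc n"])
  \<comment> \<open>Half-step from \<open>a\<close> to \<open>b\<close>. The height of
    \<open>a (Suc n)\<close> above the edge is added to the old correction, so \<open>q\<close>
    stays a nonnegative multiple of \<open>axis 2 1\<close>.\<close>
  have B: "b (Suc n) = edge_point (?t n) \<and> (\<exists>h\<ge>0. q (Suc n) = h *\<^sub>R axis 2 1)"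
    if a: "a (Suc n) = u - ?t n *\<^sub>R w" and q: "\<exists>h\<ge>0. q n = h *\<^sub>R axis 2 1" for n
  proof -
    from q obtain h where h: "h \<ge> 0" "q n = h *\<^sub>R axis 2 1" by blast
    have b: "b (Suc n) = edge_point (?t n)"
      using closest_point_square_line[OF t h(1)] unfolding step(3) a h(2) .
    have "q (Suc n) = (h + ?t n * v $ 1) *\<^sub>R axis 2 1"
      by (simp add: step(4) a b h(2) edge_point_def vec_eq_iff forall_2 axis_def)
    moreover have "0 \<le> h + ?t n * v $ 1"
      by (rule add_nonneg_nonneg[OF h(1) mult_nonneg_nonneg[OF t(1) less_imp_le[OF v(1)]]])
    ultimately show ?thesis using b by blast
  qed
  have P: "\<exists>k. p (Suc n) = k *\<^sub>R v" for n
  proof -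
    let ?x = "b n + p n"
    have "a (Suc n) = u + (w \<bullet> (?x - u)) *\<^sub>R w"
      unfolding step(1) by (rule closest_point_line_eq)
    then have "p (Suc n) = (v \<bullet> (?x - u)) *\<^sub>R v"
      unfolding step(2) using decompose[of ?x] by (metis add_diff_cancel_left')
    then show ?thesis ..
  qed
  \<comment> \<open>The claim is strengthened by the invariant on \<open>q\<close>, which the next
    use of \<open>B\<close> requires.\<close>
  have "a (Suc n) = u - ?t n *\<^sub>R w \<and> b (Suc n) = edge_point (?t n) \<and>
      (\<exists>h\<ge>0. q (Suc n) = h *\<^sub>R axis 2 1)"
  proof (induction n)
    case 0
    then show ?case using B[of 0] a1 init by force
  next
    case (Suc n)
    obtain k where "p (Suc n) = k *\<^sub>R v" using P by blast
    then have "a (Suc (Suc n)) = u - ?t (Suc n) *\<^sub>R w"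
      using Suc closest_point_line_edge by (simp add: step(1) mult_ac)
    then show ?case using B Suc by blast
  qed
  then show ?thesis by blast
qed

lemma MAP_closed_form:
  assumes M: "MAP line square z c"
    and c1: "c 1 = u - s *\<^sub>R w" and s: "0 \<le> s" "s * v $ 2 \<le> u $ 1 + 1"
  shows "c (2 * n + 1) = u - (s * ((v $ 2)\<^sup>2) ^ n) *\<^sub>R w \<and>
    c (2 * n + 2) = edge_point (s * ((v $ 2)\<^sup>2) ^ n)"
proof -
  let ?t = "\<lambda>n. s * ((v $ 2)\<^sup>2) ^ n"
  have "c (2 * Suc n - 1) = closest_point line (c (2 * Suc n - 2)) \<and>
      c (2 * Suc n) = closest_point square (c (2 * Suc n - 1))" for n
    using M unfolding MAP_def by (metis le_add1 plus_1_eq_Suc)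
  then have step: "c (2 * n + 1) = closest_point line (c (2 * n))"
      "c (2 * n + 2) = closest_point square (c (2 * n + 1))" for n
    by simp_all
  have B: "c (2 * n + 2) = edge_point (?t n)" if "c (2 * n + 1) = u - ?t n *\<^sub>R w" for n
    using closest_point_square_line[OF closed_form_bounds[OF s], of 0] that step(2) by simp
  show ?thesis
  proof (induction n)
    case 0
    then show ?case using c1 B[of 0] by simp
  next
    case (Suc n)
    \<comment> \<open>The zero multiple of \<open>v\<close> makes this an instance of the step
      already used for Dykstra.\<close>
    have "c (2 * Suc n + 1) = closest_point line (edge_point (?t n) + 0 *\<^sub>R v)"
      using Suc step(1)[of "Suc n"] by simp
    then have "c (2 * Suc n + 1) = u - ?t (Suc n) *\<^sub>R w"
      unfolding closest_point_line_edge by (simp add: mult_ac)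
    then show ?case using B by blast
  qed
qed

section \<open>The common limit\<close>

lemma closest_point_line_inter_square:
  assumes "closest_point line z = u - s *\<^sub>R w" "0 \<le> s"
  shows "closest_point (line \<inter> square) z = u"
proof (rule closest_point_eqI)
  have line: "line = {y. v \<bullet> y = v \<bullet> u}"
    by (auto simp: line_def inner_diff_right)
  show "convex (line \<inter> square)"
    unfolding line by (intro convex_Int convex_square convex_hyperplane)
  show "closed (line \<inter> square)"
    unfolding line by (intro closed_Int closed_square closed_hyperplane)
  show "u \<in> line \<inter> square"
    using u1 u2 by (simp add: line_def square_def)
  fix y assume y: "y \<in> line \<inter> square"
  define t where "t = w \<bullet> (y - u)"
  have t: "y - u = t *\<^sub>R w"
    using decompose[of y] y by (simp add: t_def line_def algebra_simps)
  have "y $ 2 = 1 - t * v $ 1"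
    using arg_cong[OF t, of "\<lambda>x. x $ 2"] u2 by simp
  \<comment> \<open>Moving along \<open>-w\<close> from \<open>u\<close> would leave the square
    through its upper edge.\<close>
  then have "0 \<le> t"
    using y v by (simp add: square_def zero_le_mult_iff)
  have "(w \<bullet> (z - u)) *\<^sub>R w = (- s) *\<^sub>R w"
    using assms(1) by (simp add: closest_point_line_eq)
  \<comment> \<open>Comparing first coordinates allows cancelling \<open>w\<close>, since
    \<open>w $ 1 = v $ 2\<close> is nonzero.\<close>
  from arg_cong[OF this, of "\<lambda>x. x $ 1"] have "(w \<bullet> (z - u)) * v $ 2 = - s * v $ 2"
    by simp
  then have "(z - u) \<bullet> w = - s"
    using v(2) mult_right_cancel[of "v $ 2" "w \<bullet> (z - u)" "- s"] by (simp add: inner_commute)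
  then show "(z - u) \<bullet> (y - u) \<le> 0"
    using \<open>0 \<le> t\<close> \<open>0 \<le> s\<close> by (simp add: t)
qed

lemma line_points_tendsto: "(\<lambda>n. u - (s * ((v $ 2)\<^sup>2) ^ n) *\<^sub>R w) \<longlonglongrightarrow> u"
  and edge_points_tendsto: "(\<lambda>n. edge_point (s * ((v $ 2)\<^sup>2) ^ n)) \<longlonglongrightarrow> u"
proof -
  have *: "(\<lambda>n. ((v $ 2)\<^sup>2) ^ n) \<longlonglongrightarrow> 0"
    using ratio by (intro LIMSEQ_realpow_zero) auto
  show "(\<lambda>n. u - (s * ((v $ 2)\<^sup>2) ^ n) *\<^sub>R w) \<longlonglongrightarrow> u"
    by (rule tendsto_eq_intros * refl | simp)+
  show "(\<lambda>n. edge_point (s * ((v $ 2)\<^sup>2) ^ n)) \<longlonglongrightarrow> u"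
    unfolding edge_point_def by (rule tendsto_eq_intros * refl | simp)+
qed

lemma closed_forms_neq:
  assumes "s \<noteq> 0"
  shows "u - (s * ((v $ 2)\<^sup>2) ^ n) *\<^sub>R w \<noteq> u" "edge_point (s * ((v $ 2)\<^sup>2) ^ n) \<noteq> u"
proof -
  have "w \<noteq> 0" using v(2) w_simps(1) by (metis less_irrefl zero_index)
  then show "u - (s * ((v $ 2)\<^sup>2) ^ n) *\<^sub>R w \<noteq> u" "edge_point (s * ((v $ 2)\<^sup>2) ^ n) \<noteq> u"
    using assms v(2) by (auto simp: edge_point_def)
qed

end

section \<open>Transfer to the given sets and sequences\<close>

theorem theorem4p3:
  fixes A B :: "(real^2) set" and u v z :: "real^2"
    and a b p q c :: "nat \<Rightarrow> real^2"
  assumes "B = {x. x $ 1 \<in> {-1..1} \<and> x $ 2 \<in> {-1..1}}"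
    and "A = {u + w | w. w \<in> orthogonal_comp {v}}"
    and "u \<in> A \<inter> B" and "u $ 1 > -1" and "u $ 2 = 1"
    and "v \<in> orthogonal_comp {x - y | x y. x \<in> A \<and> y \<in> A}"
    and "norm v = 1" and "v $ 1 > 0" and "v $ 2 > 0"
    and "dykstra A B z a b p q"
    and "MAP A B z c"
    and "-1 < a 1 $ 1" and "a 1 $ 1 < u $ 1" and "1 < a 1 $ 2"
  shows "(\<forall>n\<ge>1. c (2 * n - 1) = a n \<and> c (2 * n) = b n) \<and>
    infinite_convergence a (closest_point (A \<inter> B) z) \<and>
    infinite_convergence b (closest_point (A \<inter> B) z) \<and>
    infinite_convergence c (closest_point (A \<inter> B) z)"
proof -
  interpret line_square u v
    using assms by unfold_locales auto
  have B: "B = square"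
    using assms(1) by (simp add: square_def)
  have A: "A = line"
  proof -
    have "x = u + (x - u)" for x by simp
    then show ?thesis
      unfolding assms(2) line_def orthogonal_comp_def orthogonal_def by force
  qed
  \<comment> \<open>The sign is chosen so that \<open>s > 0\<close> when \<open>a 1\<close> lies to
    the left of \<open>u\<close>.\<close>
  define s where "s = - (w \<bullet> (z - u))"
  have P: "closest_point line z = u - s *\<^sub>R w"
    by (simp add: s_def closest_point_line_eq)
  have D: "dykstra line square z a b p q" and M: "MAP line square z c"
    using assms A B by simp_all
  have a1: "a 1 = u - s *\<^sub>R w"
    using D P by (simp add: dykstra_def)
  have c1: "c 1 = u - s *\<^sub>R w"
    using M P unfolding MAP_def by (metis diff_self_eq_0 le_refl mult.right_neutral
        nat_1_add_1 add_diff_cancel_left')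
  \<comment> \<open>The first coordinate of \<open>a 1\<close> is \<open>u $ 1 - s * v $ 2\<close>,
    which lies strictly between \<open>-1\<close> and \<open>u $ 1\<close>.\<close>
  have "0 < s * v $ 2" "s * v $ 2 \<le> u $ 1 + 1"
    using assms(12,13) unfolding a1 by simp_all
  then have s: "0 < s" "0 \<le> s" "s * v $ 2 \<le> u $ 1 + 1"
    using v(2) by (simp_all add: zero_less_mult_iff)
  have u: "closest_point (A \<inter> B) z = u"
    unfolding A B using P s(2) by (rule closest_point_line_inter_square)
  note ab = dykstra_closed_form[OF D a1 s(2,3)]
  have c: "c (2 * n + 1) = a (Suc n)" "c (2 * n + 2) = b (Suc n)" for n
    using ab[of n] MAP_closed_form[OF M c1 s(2,3), of n] by simp_all
  have c': "c (2 * n - 1) = a n \<and> c (2 * n) = b n" if "n \<ge> 1" for n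
    using c[of "n - 1"] that by (cases n) simp_all
  \<comment> \<open>The shift skips index 0, where the closed forms say nothing.\<close>
  have lim: "a \<longlonglongrightarrow> u" "b \<longlonglongrightarrow> u"
    by (rule LIMSEQ_imp_Suc, simp only: ab line_points_tendsto edge_points_tendsto)+
  have neq: "a (Suc n) \<noteq> u" "b (Suc n) \<noteq> u" for n
    using ab[of n] closed_forms_neq[of s n] s(1) by simp_all
  have "(\<lambda>n. c (2 * n)) \<longlonglongrightarrow> u"
  proof (rule LIMSEQ_imp_Suc)
    show "(\<lambda>n. c (2 * Suc n)) \<longlonglongrightarrow> u"
      using LIMSEQ_Suc[OF lim(2)] c(2) by simp
  qed
  moreover have "(\<lambda>n. c (2 * n + 1)) \<longlonglongrightarrow> u"
    using LIMSEQ_Suc[OF lim(1)] by (simp only: c(1))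
  ultimately have "c \<longlonglongrightarrow> u"
    by (rule limseq_even_odd)
  moreover have "c n \<noteq> u" if "n \<ge> 1" for n
  proof (cases "even n")
    case True
    \<comment> \<open>A positive even \<open>n\<close> is at least 2, so the truncated subtraction
      is exact.\<close>
    then have "n = 2 * (n div 2 - 1) + 2"
      using that by presburger
    then show ?thesis using c(2) neq(2) by metis
  next
    case False
    then obtain k where "n = 2 * k + 1" by (elim oddE)
    then show ?thesis using c(1)[of k] neq(1)[of k] by simp
  qed
  moreover have "a n \<noteq> u" "b n \<noteq> u" if "n \<ge> 1" for n
    using that neq[of "n - 1"] by simp_all
  ultimately show ?thesis
    using c' lim by (simp add: u infinite_convergence_def)
qed

end
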